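(* Let $X$ be a Tychonoff space. Then: (1) $\delta(\beta(X))=X$ if and only if $X$ is discrete; (2) $\beta(\delta(X))=X$ if and only if $X$ is Stonean and $\alpha$-scattered. Here the equality in (1) means $\delta(\beta X)=\beta_X(X)$ as subsets of $\beta X$, where $\beta_X:X\to\beta X$ is the canonical embedding, and the equality in (2) means that $X$, together with the inclusion map $\delta X\hookrightarrow X$, is the Stone-Čech compactification of the discrete space $\delta X$.
   Context: $\delta(X)=\delta X$ denotes the set of isolated points of $X$ (with the subspace topology, which is discrete). $\beta X$ is the Stone-Čech compactification of $X$. A Hausdorff space is extremely (extremally) disconnected if the closure of every open subset is open; a compact extremely disconnected Hausdorff space is called Stonean. For a space $X=(X,\tau)$, let $X^{\alpha}=(X,\tau^{\alpha})$, where $\tau^{\alpha}=\{U\setminus N : U\in\tau \text{ and } N \text{ is nowhere dense in } X\}$. A space is scattered if every nonempty subspace has an isolated point, and $X$ is $\alpha$-scattered if $X^{\alpha}$ is scattered. *)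

theory Defs
  imports "HOL-Analysis.Analysis"
begin

definition isolated_points :: "'a topology \<Rightarrow> 'a set" where
  "isolated_points X = {x \<in> topspace X. openin X {x}}"

definition tychonoff_space :: "'a topology \<Rightarrow> bool" where
  "tychonoff_space X \<longleftrightarrow> completely_regular_space X \<and> Hausdorff_space X"

definition extremally_disconnected_space :: "'a topology \<Rightarrow> bool" where
  "extremally_disconnected_space X \<longleftrightarrow>
     Hausdorff_space X \<and> (\<forall>U. openin X U \<longrightarrow> openin X (X closure_of U))"

definition stonean_space :: "'a topology \<Rightarrow> bool" where
  "stonean_space X \<longleftrightarrow> compact_space X \<and> extremally_disconnected_space X"

definition scattered_space :: "'a topology \<Rightarrow> bool" where
  "scattered_space X \<longleftrightarrow>
     (\<forall>S. S \<subseteq> topspace X \<and> S \<noteq> {} \<longrightarrow> isolated_points (subtopology X S) \<noteq> {})"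

definition nowhere_dense_in :: "'a topology \<Rightarrow> 'a set \<Rightarrow> bool" where
  "nowhere_dense_in X N \<longleftrightarrow> N \<subseteq> topspace X \<and> X interior_of (X closure_of N) = {}"

definition alpha_topology :: "'a topology \<Rightarrow> 'a topology" where
  "alpha_topology X = topology (\<lambda>V. \<exists>U N. openin X U \<and> nowhere_dense_in X N \<and> V = U - N)"

definition alpha_scattered_space :: "'a topology \<Rightarrow> bool" where
  "alpha_scattered_space X \<longleftrightarrow> scattered_space (alpha_topology X)"

text \<open>
  The Stone-Cech compactification is the closure of the image of the evaluation map in the
  cube indexed by the continuous functions from the space to the unit interval. The functions are
  taken to be extensional so that each continuous map on the carrier is counted exactly once.
\<close>

definition unit_interval_maps :: "'a topology \<Rightarrow> ('a \<Rightarrow> real) set" where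
  "unit_interval_maps X =
     {f \<in> extensional (topspace X). continuous_map X (top_of_set {0..1}) f}"

definition stone_cech_cube :: "'a topology \<Rightarrow> (('a \<Rightarrow> real) \<Rightarrow> real) topology" where
  "stone_cech_cube X = product_topology (\<lambda>f. top_of_set {0..1}) (unit_interval_maps X)"

definition stone_cech_map :: "'a topology \<Rightarrow> 'a \<Rightarrow> ('a \<Rightarrow> real) \<Rightarrow> real" where
  "stone_cech_map X x = (\<lambda>f \<in> unit_interval_maps X. f x)"

definition stone_cech :: "'a topology \<Rightarrow> (('a \<Rightarrow> real) \<Rightarrow> real) topology" where
  "stone_cech X =
     subtopology (stone_cech_cube X) (stone_cech_cube X closure_of (stone_cech_map X ` topspace X))"

text \<open>
  The space \<open>Y\<close> together with the map \<open>e\<close> is the Stone-Cech compactification of \<open>X\<close>, in the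
  usual sense of being isomorphic to the one above by a homeomorphism that respects the maps
  from \<open>X\<close>.
\<close>

definition is_stone_cech_compactification ::
    "'a topology \<Rightarrow> 'b topology \<Rightarrow> ('a \<Rightarrow> 'b) \<Rightarrow> bool" where
  "is_stone_cech_compactification X Y e \<longleftrightarrow>
     (\<exists>h. homeomorphic_map (stone_cech X) Y h \<and>
          (\<forall>x \<in> topspace X. h (stone_cech_map X x) = e x))"

text \<open>
  The definition of the alpha topology uses \<^const>\<open>topology\<close>, which is meaningful only
  because the sets in question do form a topology.
\<close>

lemma nowhere_dense_in_iff:
  "nowhere_dense_in X N \<longleftrightarrow> N \<subseteq> topspace X \<and>
     (\<forall>W. openin X W \<and> W \<noteq> {} \<longrightarrow> (\<exists>V. openin X V \<and> V \<noteq> {} \<and> V \<subseteq> W \<and> V \<inter> N = {}))"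
proof (intro iffI conjI allI impI)
  fix W assume N: "nowhere_dense_in X N" and W: "openin X W \<and> W \<noteq> {}"
  have "\<not> W \<subseteq> X closure_of N"
    using N W by (auto simp: nowhere_dense_in_def interior_of_eq_empty)
  then have "openin X (W - X closure_of N)" "W - X closure_of N \<noteq> {}"
    using W by (auto intro: openin_diff)
  moreover have "(W - X closure_of N) \<inter> N = {}"
    using N closure_of_subset[of N X] by (auto simp: nowhere_dense_in_def)
  ultimately show "\<exists>V. openin X V \<and> V \<noteq> {} \<and> V \<subseteq> W \<and> V \<inter> N = {}" by blast
next
  assume *: "N \<subseteq> topspace X \<and>
     (\<forall>W. openin X W \<and> W \<noteq> {} \<longrightarrow> (\<exists>V. openin X V \<and> V \<noteq> {} \<and> V \<subseteq> W \<and> V \<inter> N = {}))"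
  have "W = {}" if W: "openin X W" "W \<subseteq> X closure_of N" for W
  proof (rule ccontr)
    assume "W \<noteq> {}"
    then obtain V where V: "openin X V" "V \<noteq> {}" "V \<subseteq> W" "V \<inter> N = {}"
      using * W by blast
    then have "V \<inter> X closure_of N = {}"
      by (simp add: openin_Int_closure_of_eq_empty)
    with V W show False by blast
  qed
  with * show "nowhere_dense_in X N"
    by (auto simp: nowhere_dense_in_def interior_of_eq_empty)
qed (auto simp: nowhere_dense_in_def)

lemma nowhere_dense_in_Un:
  assumes "nowhere_dense_in X M" "nowhere_dense_in X N"
  shows "nowhere_dense_in X (M \<union> N)"
  unfolding nowhere_dense_in_iff
proof (intro conjI allI impI)
  show "M \<union> N \<subseteq> topspace X" using assms by (auto simp: nowhere_dense_in_def)
  fix W assume "openin X W \<and> W \<noteq> {}"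
  then obtain V where V: "openin X V" "V \<noteq> {}" "V \<subseteq> W" "V \<inter> M = {}"
    using assms(1) unfolding nowhere_dense_in_iff by meson
  then obtain V' where "openin X V'" "V' \<noteq> {}" "V' \<subseteq> V" "V' \<inter> N = {}"
    using assms(2) unfolding nowhere_dense_in_iff by meson
  with V show "\<exists>V. openin X V \<and> V \<noteq> {} \<and> V \<subseteq> W \<and> V \<inter> (M \<union> N) = {}"
    by (intro exI[of _ V']) blast
qed

lemma istopology_alpha:
  "istopology (\<lambda>V. \<exists>U N. openin X U \<and> nowhere_dense_in X N \<and> V = U - N)"
  unfolding istopology_def
proof (intro conjI allI impI)
  fix S T
  assume "\<exists>U N. openin X U \<and> nowhere_dense_in X N \<and> S = U - N"
    and "\<exists>U N. openin X U \<and> nowhere_dense_in X N \<and> T = U - N"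
  then obtain U N U' N' where *: "openin X U" "nowhere_dense_in X N" "S = U - N"
      "openin X U'" "nowhere_dense_in X N'" "T = U' - N'"
    by blast
  then have "openin X (U \<inter> U')" "nowhere_dense_in X (N \<union> N')" "S \<inter> T = (U \<inter> U') - (N \<union> N')"
    by (auto intro: nowhere_dense_in_Un)
  then show "\<exists>U N. openin X U \<and> nowhere_dense_in X N \<and> S \<inter> T = U - N" by blast
next
  fix \<K> :: "'a set set"
  assume "\<forall>K\<in>\<K>. \<exists>U N. openin X U \<and> nowhere_dense_in X N \<and> K = U - N"
  then obtain U N where *: "\<And>K. K \<in> \<K> \<Longrightarrow> openin X (U K) \<and> nowhere_dense_in X (N K) \<and> K = U K - N K"
    by metis
  define G where "G = (\<Union>K\<in>\<K>. U K)"
  have G: "openin X G" unfolding G_def using * by auto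
  have "nowhere_dense_in X (G - \<Union>\<K>)"
    unfolding nowhere_dense_in_iff
  proof (intro conjI allI impI)
    show "G - \<Union>\<K> \<subseteq> topspace X" using openin_subset[OF G] by blast
    fix W assume W: "openin X W \<and> W \<noteq> {}"
    show "\<exists>V. openin X V \<and> V \<noteq> {} \<and> V \<subseteq> W \<and> V \<inter> (G - \<Union>\<K>) = {}"
    proof (cases "W \<inter> G = {}")
      case True
      with W show ?thesis by blast
    next
      case False
      then obtain K where K: "K \<in> \<K>" "W \<inter> U K \<noteq> {}" unfolding G_def by blast
      then have "openin X (W \<inter> U K)" using W * by blast
      moreover have "nowhere_dense_in X (N K)" using * K by blast
      ultimately obtain V where "openin X V" "V \<noteq> {}" "V \<subseteq> W \<inter> U K" "V \<inter> N K = {}"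
        using K unfolding nowhere_dense_in_iff by meson
      moreover have "K = U K - N K" using * K by blast
      ultimately show ?thesis using K(1) by (intro exI[of _ V]) blast
    qed
  qed
  moreover have "\<Union>\<K> \<subseteq> G" unfolding G_def using * by blast
  then have "\<Union>\<K> = G - (G - \<Union>\<K>)" by blast
  ultimately show "\<exists>U N. openin X U \<and> nowhere_dense_in X N \<and> \<Union>\<K> = U - N" using G by blast
qed

lemma openin_alpha_topology:
  "openin (alpha_topology X) V \<longleftrightarrow> (\<exists>U N. openin X U \<and> nowhere_dense_in X N \<and> V = U - N)"
  unfolding alpha_topology_def topology_inverse'[OF istopology_alpha] by (rule refl)

end

theory Submission
  imports Defs
begin

text \<open>
  In the compactification of a discrete space \<open>D\<close>, the closure of the image of any \<open>A \<subseteq> D\<close> is open,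
  as the coordinate given by the indicator function of \<open>A\<close> only takes the values 0 and 1. With \<open>A\<close> a
  singleton this yields (1); since every open set has the same closure as its trace on \<open>D\<close>, it also
  shows that the compactification is Stonean.

  For (2), alpha-scatteredness of \<open>X\<close> amounts to density of the isolated points: an alpha-open
  singleton is already open, and nowhere dense sets are discrete in the alpha topology. If \<open>X\<close> is
  Stonean and \<open>D = \<delta>X\<close> is dense, the inclusion of \<open>D\<close> extends to a surjection from the
  compactification of \<open>D\<close>. It is injective because distinct points lie in the closures of disjoint
  subsets of \<open>D\<close>, and disjoint open sets have disjoint closures in \<open>X\<close>.
\<close>

section \<open>The Stone-Cech compactification\<close>

lemma restrict_in_unit_interval_maps:
  assumes "continuous_map X (top_of_set {0..1}) f"
  shows "restrict f (topspace X) \<in> unit_interval_maps X"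
  using continuous_map_eq[OF assms] by (simp add: unit_interval_maps_def)

lemma compact_space_stone_cech_cube: "compact_space (stone_cech_cube X)"
  by (simp add: stone_cech_cube_def compact_space_product_topology compact_space_subtopology)

lemma Hausdorff_space_stone_cech_cube: "Hausdorff_space (stone_cech_cube X)"
  by (simp add: stone_cech_cube_def Hausdorff_space_product_topology Hausdorff_space_subtopology)

lemma compact_space_stone_cech: "compact_space (stone_cech X)"
  unfolding stone_cech_def
  by (intro compact_space_subtopology closedin_compact_space[OF compact_space_stone_cech_cube]) simp

lemma Hausdorff_space_stone_cech: "Hausdorff_space (stone_cech X)"
  unfolding stone_cech_def by (intro Hausdorff_space_subtopology Hausdorff_space_stone_cech_cube)

lemma continuous_map_stone_cech_map_cube: "continuous_map X (stone_cech_cube X) (stone_cech_map X)"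
  unfolding stone_cech_cube_def continuous_map_componentwise
proof (intro conjI ballI)
  show "stone_cech_map X ` topspace X \<subseteq> extensional (unit_interval_maps X)"
    by (auto simp: stone_cech_map_def)
  fix f assume "f \<in> unit_interval_maps X"
  then show "continuous_map X (top_of_set {0..1}) (\<lambda>x. stone_cech_map X x f)"
    by (simp add: stone_cech_map_def unit_interval_maps_def)
qed

lemma stone_cech_map_image_subset_cube:
  "stone_cech_map X ` topspace X \<subseteq> topspace (stone_cech_cube X)"
  using continuous_map_image_subset_topspace[OF continuous_map_stone_cech_map_cube] .

lemma topspace_stone_cech:
  "topspace (stone_cech X) = stone_cech_cube X closure_of (stone_cech_map X ` topspace X)"
  unfolding stone_cech_def
  using closure_of_subset_topspace by (fastforce simp: topspace_subtopology)

lemma stone_cech_map_image_subset: "stone_cech_map X ` topspace X \<subseteq> topspace (stone_cech X)"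
  unfolding topspace_stone_cech by (rule closure_of_subset[OF stone_cech_map_image_subset_cube])

lemma continuous_map_stone_cech_map: "continuous_map X (stone_cech X) (stone_cech_map X)"
  using continuous_map_stone_cech_map_cube[of X] closure_of_subset[OF stone_cech_map_image_subset_cube[of X]]
  by (simp add: stone_cech_def continuous_map_in_subtopology image_subset_iff_funcset)

lemma closure_of_stone_cech_map_image:
  "stone_cech X closure_of (stone_cech_map X ` topspace X) = topspace (stone_cech X)"
proof -
  let ?I = "stone_cech_map X ` topspace X"
  have "?I \<subseteq> stone_cech_cube X closure_of ?I"
    by (rule closure_of_subset[OF stone_cech_map_image_subset_cube])
  then have "stone_cech_cube X closure_of ?I \<inter> ?I = ?I" by blast
  then show ?thesis
    unfolding topspace_stone_cech unfolding stone_cech_def closure_of_subtopology by simp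
qed

text \<open>The projection to the coordinate \<open>f\<close> takes the value \<open>f x\<close> at
  \<open>stone_cech_map X x\<close>, so it extends \<open>f\<close> continuously to the
  compactification.\<close>

lemma continuous_map_stone_cech_component:
  assumes "f \<in> unit_interval_maps X"
  shows "continuous_map (stone_cech X) (top_of_set {0..1}) (\<lambda>p. p f)"
  unfolding stone_cech_def stone_cech_cube_def
  by (intro continuous_map_from_subtopology continuous_map_product_projection assms)

text \<open>Points of the cube are extensional functions on the index set, so their coordinates
  determine them.\<close>

lemma stone_cech_eqI:
  assumes "p \<in> topspace (stone_cech X)" "q \<in> topspace (stone_cech X)"
    and "\<And>f. f \<in> unit_interval_maps X \<Longrightarrow> p f = q f"
  shows "p = q"
proof -
  have "topspace (stone_cech X) \<subseteq> topspace (stone_cech_cube X)"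
    unfolding topspace_stone_cech by (rule closure_of_subset_topspace)
  also have "\<dots> \<subseteq> extensional (unit_interval_maps X)"
    by (auto simp: stone_cech_cube_def PiE_def)
  finally have "topspace (stone_cech X) \<subseteq> extensional (unit_interval_maps X)" .
  then have "p \<in> extensional (unit_interval_maps X)" "q \<in> extensional (unit_interval_maps X)"
    using assms(1,2) by blast+
  then show ?thesis using assms(3) by (rule extensionalityI)
qed

text \<open>Complete regularity gives a map into the unit interval that separates \<open>x\<close>
  from the closed set \<open>{y}\<close>; after restriction to the carrier it is a coordinate on
  which the two images differ.\<close>

lemma inj_on_stone_cech_map:
  assumes "tychonoff_space X"
  shows "inj_on (stone_cech_map X) (topspace X)"
proof (rule inj_onI, rule ccontr)
  fix x y
  assume x: "x \<in> topspace X" and y: "y \<in> topspace X"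
    and eq: "stone_cech_map X x = stone_cech_map X y" and "x \<noteq> y"
  have "closedin X {y}"
    using assms y by (simp add: tychonoff_space_def closedin_Hausdorff_singleton)
  moreover have "x \<in> topspace X - {y}" using x \<open>x \<noteq> y\<close> by simp
  ultimately obtain f where f: "continuous_map X (top_of_set {0..1::real}) f" "f x = 0" "f ` {y} \<subseteq> {1}"
    using assms unfolding tychonoff_space_def completely_regular_space_def by meson
  define g where "g = restrict f (topspace X)"
  have "g \<in> unit_interval_maps X"
    unfolding g_def by (rule restrict_in_unit_interval_maps[OF f(1)])
  then have "g x = g y"
    using fun_cong[OF eq, of g] by (simp add: stone_cech_map_def)
  then show False using f x y by (simp add: g_def)
qed

lemma compact_Hausdorff_imp_tychonoff_space:
  "\<lbrakk>compact_space X; Hausdorff_space X\<rbrakk> \<Longrightarrow> tychonoff_space X"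
  by (simp add: tychonoff_space_def compact_imp_locally_compact_space
      locally_compact_regular_imp_completely_regular_space)

text \<open>The universal property, by functoriality: \<open>g\<close> induces a map
  \<open>r\<close> into the cube of \<open>K\<close>. Its values lie in the image of
  \<open>K\<close>, which is homeomorphic to \<open>K\<close> as \<open>K\<close> is compact
  Hausdorff, so \<open>r\<close> can be followed by the inverse \<open>k\<close> of that
  embedding.\<close>

lemma stone_cech_extension:
  assumes g: "continuous_map X K g" and K: "compact_space K" "Hausdorff_space K"
  obtains h where "continuous_map (stone_cech X) K h"
    "\<And>x. x \<in> topspace X \<Longrightarrow> h (stone_cech_map X x) = g x"
proof -
  \<comment> \<open>Coordinates are reindexed by precomposition with \<open>g\<close>; the inner
    \<open>restrict\<close> is there because the index set of the cube of \<open>X\<close> contains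
    only extensional functions.\<close>
  define r where "r p = (\<lambda>\<phi> \<in> unit_interval_maps K. p (restrict (\<phi> \<circ> g) (topspace X)))" for p :: "('a \<Rightarrow> real) \<Rightarrow> real"
  have pull: "restrict (\<phi> \<circ> g) (topspace X) \<in> unit_interval_maps X"
    if "\<phi> \<in> unit_interval_maps K" for \<phi>
    using that g
    by (intro restrict_in_unit_interval_maps) (auto simp: unit_interval_maps_def intro: continuous_map_compose)
  have r_cube: "continuous_map (stone_cech X) (stone_cech_cube K) r"
    unfolding stone_cech_cube_def continuous_map_componentwise
  proof (intro conjI ballI)
    show "r ` topspace (stone_cech X) \<subseteq> extensional (unit_interval_maps K)"
      by (auto simp: r_def)
    fix \<phi> assume "\<phi> \<in> unit_interval_maps K"
    then show "continuous_map (stone_cech X) (top_of_set {0..1}) (\<lambda>p. r p \<phi>)"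
      using continuous_map_stone_cech_component[OF pull] by (simp add: r_def)
  qed
  have gx: "g x \<in> topspace K" if "x \<in> topspace X" for x
    using continuous_map_image_subset_topspace[OF g] that by blast
  have re: "r (stone_cech_map X x) = stone_cech_map K (g x)" if "x \<in> topspace X" for x
    using that pull by (auto simp: r_def stone_cech_map_def fun_eq_iff)
  let ?I = "stone_cech_map K ` topspace K"
  let ?S = "subtopology (stone_cech_cube K) ?I"
  \<comment> \<open>The image of \<open>K\<close> is compact, hence closed in the Hausdorff cube. As
    \<open>r\<close> sends the dense image of \<open>X\<close> into it, \<open>r\<close> sends the
    whole compactification into it.\<close>
  have "compactin (stone_cech_cube K) ?I"
    using K(1) continuous_map_stone_cech_map_cube by (intro image_compactin) (auto simp: compact_space_def)
  then have "closedin (stone_cech_cube K) ?I"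
    by (rule compactin_imp_closedin[OF Hausdorff_space_stone_cech_cube])
  moreover have "r ` stone_cech_map X ` topspace X \<subseteq> ?I"
    using re gx by auto
  ultimately have "stone_cech_cube K closure_of (r ` stone_cech_map X ` topspace X) \<subseteq> ?I"
    by (rule closure_of_minimal[rotated])
  then have "r ` topspace (stone_cech X) \<subseteq> ?I"
    using continuous_map_image_closure_subset[OF r_cube, of "stone_cech_map X ` topspace X"]
    unfolding closure_of_stone_cech_map_image by blast
  then have r: "continuous_map (stone_cech X) ?S r"
    using r_cube by (simp add: continuous_map_in_subtopology image_subset_iff_funcset)
  have "homeomorphic_map K ?S (stone_cech_map K)"
  proof (rule continuous_imp_homeomorphic_map)
    show "continuous_map K ?S (stone_cech_map K)"
      using continuous_map_stone_cech_map_cube by (auto simp: continuous_map_in_subtopology)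
    show "stone_cech_map K ` topspace K = topspace ?S"
      using stone_cech_map_image_subset_cube by (fastforce simp: topspace_subtopology)
  qed (use K in \<open>auto intro: Hausdorff_space_subtopology Hausdorff_space_stone_cech_cube
      inj_on_stone_cech_map compact_Hausdorff_imp_tychonoff_space\<close>)
  then obtain k where k: "homeomorphic_maps K ?S (stone_cech_map K) k"
    by (auto simp: homeomorphic_map_maps)
  show thesis
  proof (rule that[of "k \<circ> r"])
    show "continuous_map (stone_cech X) K (k \<circ> r)"
      using k r by (auto simp: homeomorphic_maps_def intro: continuous_map_compose)
    show "(k \<circ> r) (stone_cech_map X x) = g x" if "x \<in> topspace X" for x
      using k re gx that by (simp add: homeomorphic_maps_def)
  qed
qed

text \<open>The open singleton of an isolated point must meet the dense image of
  \<open>X\<close>.\<close>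

lemma isolated_points_stone_cech_subset:
  "isolated_points (stone_cech X) \<subseteq> stone_cech_map X ` topspace X"
  using closure_of_stone_cech_map_image[of X, unfolded dense_intersects_open]
  by (fastforce simp: isolated_points_def)

section \<open>Compactifications of discrete spaces\<close>

text \<open>The closure turns out to be the set \<open>C\<close> of points whose coordinate at the
  indicator function of \<open>A\<close> equals 1, and this set is clopen.\<close>

lemma openin_closure_of_stone_cech_image:
  assumes "A \<subseteq> D"
  defines "\<beta>D \<equiv> stone_cech (discrete_topology D)" and "e \<equiv> stone_cech_map (discrete_topology D)"
  shows "openin \<beta>D (\<beta>D closure_of (e ` A))"
proof -
  define f where "f = restrict (indicat_real A) D"
  have f: "f \<in> unit_interval_maps (discrete_topology D)"
    by (auto simp: f_def unit_interval_maps_def indicator_def)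
  have ef: "e x f = indicat_real A x" if "x \<in> D" for x
    using that f by (simp add: e_def stone_cech_map_def f_def)
  have cont: "continuous_map \<beta>D euclideanreal (\<lambda>p. p f)"
    using continuous_map_stone_cech_component[OF f] by (simp add: \<beta>D_def continuous_map_in_subtopology)
  have dense: "\<beta>D closure_of (e ` D) = topspace \<beta>D"
    using closure_of_stone_cech_map_image[of "discrete_topology D"] by (simp add: \<beta>D_def e_def)
  have eD: "e ` D \<subseteq> topspace \<beta>D"
    using stone_cech_map_image_subset[of "discrete_topology D"] by (simp add: \<beta>D_def e_def)
  have two: "p f \<in> {0, 1}" if "p \<in> topspace \<beta>D" for p
  proof (rule forall_in_closure_of[where P = "\<lambda>p. p f \<in> {0, 1}"])
    show "p \<in> \<beta>D closure_of (e ` D)" using that dense by simp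
    show "closedin \<beta>D {p \<in> topspace \<beta>D. p f \<in> {0, 1}}"
      by (rule closedin_continuous_map_preimage[OF cont]) auto
  qed (auto simp: ef indicator_def)
  \<comment> \<open>Any threshold strictly between 0 and 1 would do: as a superlevel set
    \<open>C\<close> is open, and by \<open>two\<close> it is also the closed fibre over 1.\<close>
  define C where "C = {p \<in> topspace \<beta>D. p f \<in> {1/2<..}}"
  have "openin \<beta>D C"
    unfolding C_def by (rule openin_continuous_map_preimage[OF cont]) auto
  have "C = {p \<in> topspace \<beta>D. p f \<in> {1}}"
    using two by (force simp: C_def)
  then have "closedin \<beta>D C"
    using closedin_continuous_map_preimage[OF cont, of "{1}"] by simp
  have "\<beta>D closure_of (e ` A) = C"
  proof
    show "\<beta>D closure_of (e ` A) \<subseteq> C"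
      by (rule closure_of_minimal[OF _ \<open>closedin \<beta>D C\<close>]) (use assms eD ef in \<open>force simp: C_def\<close>)
    have "C \<subseteq> \<beta>D closure_of (C \<inter> e ` D)"
      using openin_Int_closure_of_subset[OF \<open>openin \<beta>D C\<close>, of "e ` D"] dense by (auto simp: C_def)
    also have "\<dots> \<subseteq> \<beta>D closure_of (e ` A)"
      by (rule closure_of_mono) (auto simp: C_def ef split: split_indicator_asm)
    finally show "C \<subseteq> \<beta>D closure_of (e ` A)" .
  qed
  with \<open>openin \<beta>D C\<close> show ?thesis by simp
qed

lemma isolated_points_stone_cech_discrete:
  "isolated_points (stone_cech (discrete_topology D)) = stone_cech_map (discrete_topology D) ` D"
proof
  let ?\<beta>D = "stone_cech (discrete_topology D)" and ?e = "stone_cech_map (discrete_topology D)"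
  show "isolated_points ?\<beta>D \<subseteq> ?e ` D"
    using isolated_points_stone_cech_subset[of "discrete_topology D"] by simp
  show "?e ` D \<subseteq> isolated_points ?\<beta>D"
  proof clarify
    fix x assume "x \<in> D"
    then have x: "?e x \<in> topspace ?\<beta>D"
      using stone_cech_map_image_subset[of "discrete_topology D"] by auto
    then have "?\<beta>D closure_of (?e ` {x}) = {?e x}"
      by (simp add: closure_of_eq closedin_Hausdorff_singleton Hausdorff_space_stone_cech)
    then show "?e x \<in> isolated_points ?\<beta>D"
      using openin_closure_of_stone_cech_image[of "{x}" D] \<open>x \<in> D\<close> x by (simp add: isolated_points_def)
  qed
qed

lemma stonean_space_stone_cech_discrete: "stonean_space (stone_cech (discrete_topology D))"
  unfolding stonean_space_def extremally_disconnected_space_def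
proof (intro conjI allI impI compact_space_stone_cech Hausdorff_space_stone_cech)
  let ?\<beta>D = "stone_cech (discrete_topology D)" and ?e = "stone_cech_map (discrete_topology D)"
  fix U assume U: "openin ?\<beta>D U"
  have "U \<subseteq> ?\<beta>D closure_of (?e ` D)"
    using closure_of_stone_cech_map_image[of "discrete_topology D"] openin_subset[OF U] by simp
  then have "?\<beta>D closure_of U = ?\<beta>D closure_of (U \<inter> ?e ` D)"
    using closure_of_openin_Int_superset U by metis
  also have "U \<inter> ?e ` D = ?e ` {x \<in> D. ?e x \<in> U}" by blast
  finally show "openin ?\<beta>D (?\<beta>D closure_of U)"
    using openin_closure_of_stone_cech_image[of "{x \<in> D. ?e x \<in> U}" D] by auto
qed

lemma homeomorphic_map_stonean_space:
  assumes h: "homeomorphic_map X Y h" and X: "stonean_space X"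
  shows "stonean_space Y"
  unfolding stonean_space_def extremally_disconnected_space_def
proof (intro conjI allI impI)
  have "X homeomorphic_space Y"
    using h by (rule homeomorphic_map_imp_homeomorphic_space)
  then show "compact_space Y" "Hausdorff_space Y"
    using X homeomorphic_compact_space homeomorphic_Hausdorff_space
    by (auto simp: stonean_space_def extremally_disconnected_space_def)
  fix V assume V: "openin Y V"
  define U where "U = {x \<in> topspace X. h x \<in> V}"
  have U: "openin X U"
    unfolding U_def using openin_continuous_map_preimage[OF homeomorphic_imp_continuous_map[OF h] V] .
  have "V = h ` U"
    using homeomorphic_imp_surjective_map[OF h] openin_subset[OF V] by (auto simp: U_def)
  then have "Y closure_of V = h ` (X closure_of U)"
    using homeomorphic_map_closure_of[OF h openin_subset[OF U]] by simp
  then show "openin Y (Y closure_of V)"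
    using X U homeomorphic_map_openness_eq[OF h, of "X closure_of U"]
    by (simp add: stonean_space_def extremally_disconnected_space_def)
qed

section \<open>Isolated points and the alpha topology\<close>

text \<open>This lets the results about \<open>discrete_topology D\<close> apply to the subspace of
  isolated points.\<close>

lemma subtopology_isolated_points:
  "subtopology X (isolated_points X) = discrete_topology (isolated_points X)"
proof -
  have "openin (subtopology X (isolated_points X)) {x}" if "x \<in> isolated_points X" for x
    using that unfolding openin_subtopology isolated_points_def by blast
  then show ?thesis
    by (intro discrete_topology_unique[THEN iffD2, symmetric]) (auto simp: isolated_points_def)
qed

lemma openin_isolated_subset:
  assumes "A \<subseteq> isolated_points X"
  shows "openin X A"
proof -
  have "openin X (\<Union>a\<in>A. {a})"
    using assms by (intro openin_Union) (auto simp: isolated_points_def)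
  then show ?thesis by simp
qed

lemma topspace_alpha_topology: "topspace (alpha_topology X) = topspace X"
proof
  show "topspace (alpha_topology X) \<subseteq> topspace X"
    using openin_topspace[of "alpha_topology X"] openin_subset
    unfolding openin_alpha_topology by fastforce
  have "nowhere_dense_in X {}" by (simp add: nowhere_dense_in_def)
  then have "openin (alpha_topology X) (topspace X)"
    unfolding openin_alpha_topology by blast
  then show "topspace X \<subseteq> topspace (alpha_topology X)" by (rule openin_subset)
qed

lemma openin_imp_openin_alpha: "openin X U \<Longrightarrow> openin (alpha_topology X) U"
  unfolding openin_alpha_topology
  by (rule exI[of _ U], rule exI[of _ "{}"]) (simp add: nowhere_dense_in_def)

lemma openin_singleton_if_openin_alpha:
  assumes "openin (alpha_topology X) {x}"
  shows "openin X {x}"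
proof -
  obtain U N where U: "openin X U" "nowhere_dense_in X N" "{x} = U - N"
    using assms unfolding openin_alpha_topology by blast
  then have "U \<noteq> {}" by blast
  \<comment> \<open>A nonempty open subset of \<open>U\<close> that avoids \<open>N\<close> has no
    choice but to be \<open>{x}\<close>.\<close>
  with U obtain V where V: "openin X V" "V \<noteq> {}" "V \<subseteq> U" "V \<inter> N = {}"
    unfolding nowhere_dense_in_iff by meson
  then have "V \<subseteq> {x}" unfolding U(3) by blast
  then have "V = {x}" using V(2) subset_singletonD by fast
  with V show ?thesis by simp
qed

lemma alpha_scattered_space_iff_dense_isolated_points:
  "alpha_scattered_space X \<longleftrightarrow> X closure_of (isolated_points X) = topspace X"
    (is "?scattered \<longleftrightarrow> ?dense")
proof
  assume scattered: ?scattered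
  show ?dense
    unfolding dense_intersects_open
  proof (intro allI impI)
    fix W assume W: "openin X W \<and> W \<noteq> {}"
    then have "W \<subseteq> topspace (alpha_topology X)"
      by (simp add: topspace_alpha_topology openin_subset)
    then have "isolated_points (subtopology (alpha_topology X) W) \<noteq> {}"
      using scattered W unfolding alpha_scattered_space_def scattered_space_def by blast
    then obtain x where x: "x \<in> isolated_points (subtopology (alpha_topology X) W)" by blast
    \<comment> \<open>\<open>W\<close> is open, hence alpha-open, so a point isolated in
      \<open>W\<close> is isolated in the whole alpha topology.\<close>
    then have "openin (alpha_topology X) {x}" "x \<in> W"
      using W openin_imp_openin_alpha[of X W]
      by (auto simp: isolated_points_def openin_open_subtopology)
    then have "x \<in> isolated_points X"
      using openin_singleton_if_openin_alpha[of X x] openin_subset[of X "{x}"]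
      by (simp add: isolated_points_def)
    with \<open>x \<in> W\<close> show "isolated_points X \<inter> W \<noteq> {}" by blast
  qed
next
  assume dense: ?dense
  show ?scattered
    unfolding alpha_scattered_space_def scattered_space_def topspace_alpha_topology
  proof (intro allI impI)
    fix S assume S: "S \<subseteq> topspace X \<and> S \<noteq> {}"
    have "\<exists>x\<in>S. \<exists>G. openin (alpha_topology X) G \<and> {x} = G \<inter> S"
    proof (cases "S \<inter> isolated_points X = {}")
      case False
      then obtain x where x: "x \<in> S" "x \<in> isolated_points X" by blast
      then have "openin (alpha_topology X) {x}" "{x} = {x} \<inter> S"
        by (auto simp: isolated_points_def intro: openin_imp_openin_alpha)
      with x show ?thesis by blast
    next
      case True
      obtain x where x: "x \<in> S" using S by blast
      \<comment> \<open>Every nonempty open set contains an isolated point \<open>d\<close>, which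
        is outside \<open>S\<close> in this case; so \<open>{d}\<close> is an open subset that
        avoids \<open>S\<close>. Removing \<open>S - {x}\<close> from the whole space then leaves an
        alpha-open set that meets \<open>S\<close> only in \<open>x\<close>.\<close>
      have "nowhere_dense_in X (S - {x})"
        unfolding nowhere_dense_in_iff
      proof (intro conjI allI impI)
        show "S - {x} \<subseteq> topspace X" using S by blast
        fix W assume "openin X W \<and> W \<noteq> {}"
        then obtain d where "d \<in> isolated_points X" "d \<in> W"
          using dense unfolding dense_intersects_open by blast
        with True show "\<exists>V. openin X V \<and> V \<noteq> {} \<and> V \<subseteq> W \<and> V \<inter> (S - {x}) = {}"
          by (intro exI[of _ "{d}"]) (auto simp: isolated_points_def)
      qed
      then have "openin (alpha_topology X) (topspace X - (S - {x}))"
        unfolding openin_alpha_topology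
        by (intro exI[of _ "topspace X"] exI[of _ "S - {x}"]) simp
      moreover have "{x} = (topspace X - (S - {x})) \<inter> S" using S x by blast
      ultimately show ?thesis using x by blast
    qed
    then obtain x where "x \<in> S" "openin (subtopology (alpha_topology X) S) {x}"
      unfolding openin_subtopology by metis
    then show "isolated_points (subtopology (alpha_topology X) S) \<noteq> {}"
      using S by (auto simp: isolated_points_def topspace_alpha_topology)
  qed
qed

section \<open>Recognizing the compactification of the isolated points\<close>

text \<open>An open set disjoint from a set is disjoint from its closure. This is applied twice, the
  second time to the closure of \<open>U\<close>, which is itself open.\<close>

lemma extremally_disconnected_disjoint_closures:
  assumes X: "extremally_disconnected_space X" and "openin X U" "openin X V" "U \<inter> V = {}"
  shows "X closure_of U \<inter> X closure_of V = {}"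
proof -
  have "V \<inter> X closure_of U = {}"
    using assms openin_Int_closure_of_eq_empty[of X V U] by blast
  moreover have "openin X (X closure_of U)"
    using assms by (simp add: extremally_disconnected_space_def)
  ultimately show ?thesis
    using openin_Int_closure_of_eq_empty[of X "X closure_of U" V] by blast
qed

text \<open>Turns a bound on one coordinate of \<open>p\<close> into a subset of \<open>D\<close>
  whose image accumulates at \<open>p\<close>: the open set of points with that coordinate in
  \<open>T\<close> is replaced by its trace on the dense image of \<open>D\<close>.\<close>

lemma in_closure_of_stone_cech_image:
  fixes D :: "'a set"
  defines "\<beta>D \<equiv> stone_cech (discrete_topology D)" and "e \<equiv> stone_cech_map (discrete_topology D)"
  assumes p: "p \<in> topspace \<beta>D" and f: "f \<in> unit_interval_maps (discrete_topology D)"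
    and "p f \<in> T" "open T"
  shows "p \<in> \<beta>D closure_of (e ` {d \<in> D. f d \<in> T})"
proof -
  have cont: "continuous_map \<beta>D euclideanreal (\<lambda>p. p f)"
    using continuous_map_stone_cech_component[OF f] by (simp add: \<beta>D_def continuous_map_in_subtopology)
  define U where "U = {p \<in> topspace \<beta>D. p f \<in> T}"
  have "openin \<beta>D U"
    unfolding U_def by (rule openin_continuous_map_preimage[OF cont]) (use assms in auto)
  moreover have "p \<in> U" using assms by (simp add: U_def)
  moreover have "p \<in> \<beta>D closure_of (e ` D)"
    using closure_of_stone_cech_map_image[of "discrete_topology D"] p by (simp add: \<beta>D_def e_def)
  ultimately have "p \<in> \<beta>D closure_of (U \<inter> e ` D)"
    using openin_Int_closure_of_subset[of \<beta>D U "e ` D"] by blast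
  moreover have "U \<inter> e ` D \<subseteq> e ` {d \<in> D. f d \<in> T}"
    using f by (auto simp: U_def e_def stone_cech_map_def)
  ultimately show ?thesis using closure_of_mono by blast
qed

lemma is_stone_cech_compactification_isolated_points:
  assumes X: "stonean_space X" and dense: "X closure_of (isolated_points X) = topspace X"
  shows "is_stone_cech_compactification (discrete_topology (isolated_points X)) X (\<lambda>x. x)"
proof -
  define D where "D = isolated_points X"
  define \<beta>D where "\<beta>D = stone_cech (discrete_topology D)"
  define e where "e = stone_cech_map (discrete_topology D)"
  have D: "D \<subseteq> topspace X" by (auto simp: D_def isolated_points_def)
  have cX: "compact_space X" and eX: "extremally_disconnected_space X" and hX: "Hausdorff_space X"
    using X by (auto simp: stonean_space_def extremally_disconnected_space_def)
  have "continuous_map (discrete_topology D) X (\<lambda>x. x)" using D by auto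
  then obtain h where h: "continuous_map \<beta>D X h" and he: "\<And>x. x \<in> D \<Longrightarrow> h (e x) = x"
    using stone_cech_extension[OF _ cX hX] unfolding \<beta>D_def e_def by (metis topspace_discrete_topology)
  \<comment> \<open>A continuous map sends the closure of \<open>e\<close>
    A\<open>into the closure of its image, and\<close>h\<open>takes\<close>e \<open>A\<close> back
    to \<open>A\<close>.\<close>
  have cl: "h p \<in> X closure_of A" if "p \<in> \<beta>D closure_of (e ` A)" "A \<subseteq> D" for p A
  proof -
    have "h ` e ` A = A" using he that(2) by (force simp: image_iff)
    then show ?thesis using continuous_map_image_closure_subset[OF h, of "e ` A"] that by auto
  qed
  have "homeomorphic_map \<beta>D X h"
  proof (rule continuous_imp_homeomorphic_map[OF h _ hX])
    show cpt: "compact_space \<beta>D" by (simp add: \<beta>D_def compact_space_stone_cech)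
    show "h ` topspace \<beta>D = topspace X"
    proof
      show "h ` topspace \<beta>D \<subseteq> topspace X" by (rule continuous_map_image_subset_topspace[OF h])
      \<comment> \<open>Surjectivity: the image of \<open>h\<close> is compact, hence closed, and
        contains the dense set \<open>D\<close>.\<close>
      have "closedin X (h ` topspace \<beta>D)"
        using image_compactin[OF _ h] cpt compactin_imp_closedin[OF hX] by (auto simp: compact_space_def)
      moreover have "e ` D \<subseteq> topspace \<beta>D"
        using stone_cech_map_image_subset[of "discrete_topology D"] by (simp add: \<beta>D_def e_def)
      then have "D \<subseteq> h ` topspace \<beta>D" using he by force
      ultimately show "topspace X \<subseteq> h ` topspace \<beta>D"
        using dense closure_of_minimal unfolding D_def by metis
    qed
    have neq: "h p \<noteq> h q"
      if pq: "p \<in> topspace \<beta>D" "q \<in> topspace \<beta>D" "f \<in> unit_interval_maps (discrete_topology D)" "p f < q f"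
      for p q f
    proof -
      \<comment> \<open>The threshold \<open>t\<close> splits off the disjoint sets
        \<open>?A\<close> and \<open>?B\<close> of isolated points, both open in \<open>X\<close>,
        whose closures contain \<open>h p\<close> and \<open>h q\<close> respectively.\<close>
      obtain t where t: "p f < t" "t < q f" using dense_order_class.dense[OF pq(4)] by blast
      let ?A = "{d \<in> D. f d \<in> {..<t}}" and ?B = "{d \<in> D. f d \<in> {t<..}}"
      have "p \<in> \<beta>D closure_of (e ` ?A)" "q \<in> \<beta>D closure_of (e ` ?B)"
        using pq t unfolding \<beta>D_def e_def by (intro in_closure_of_stone_cech_image; simp)+
      then have "h p \<in> X closure_of ?A" "h q \<in> X closure_of ?B"
        using cl by auto
      moreover have "openin X ?A" "openin X ?B"
        by (auto simp: D_def intro!: openin_isolated_subset)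
      then have "X closure_of ?A \<inter> X closure_of ?B = {}"
        by (rule extremally_disconnected_disjoint_closures[OF eX]) auto
      ultimately show ?thesis by auto
    qed
    show "inj_on h (topspace \<beta>D)"
    proof (rule inj_onI)
      fix p q assume pq: "p \<in> topspace \<beta>D" "q \<in> topspace \<beta>D" "h p = h q"
      show "p = q"
        using pq(1,2) unfolding \<beta>D_def
      proof (rule stone_cech_eqI)
        fix f assume "f \<in> unit_interval_maps (discrete_topology D)"
        then show "p f = q f"
          using neq[of p q f] neq[of q p f] pq by (metis linorder_neqE)
      qed
    qed
  qed
  then show ?thesis
    using he unfolding is_stone_cech_compactification_def \<beta>D_def e_def D_def by auto
qed

text \<open>Both properties hold for the concrete compactification and its dense image of
  \<open>D\<close>; the homeomorphism \<open>h\<close> carries them over, sending that image onto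
  \<open>D\<close>.\<close>

lemma is_stone_cech_compactification_discreteD:
  assumes "is_stone_cech_compactification (discrete_topology D) X (\<lambda>x. x)"
  shows "stonean_space X" "X closure_of D = topspace X"
proof -
  obtain h where h: "homeomorphic_map (stone_cech (discrete_topology D)) X h"
    and he: "\<And>x. x \<in> D \<Longrightarrow> h (stone_cech_map (discrete_topology D) x) = x"
    using assms by (auto simp: is_stone_cech_compactification_def)
  show "stonean_space X"
    using homeomorphic_map_stonean_space[OF h stonean_space_stone_cech_discrete] .
  have "h ` stone_cech_map (discrete_topology D) ` D = D"
    using he by (force simp: image_iff)
  then show "X closure_of D = topspace X"
    using homeomorphic_map_closure_of[OF h stone_cech_map_image_subset]
      homeomorphic_imp_surjective_map[OF h]
    unfolding closure_of_stone_cech_map_image by simp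
qed

theorem theorem5p10:
  fixes X :: "'a topology"
  assumes "tychonoff_space X"
  shows "(isolated_points (stone_cech X) = stone_cech_map X ` topspace X \<longleftrightarrow>
           X = discrete_topology (topspace X)) \<and>
         (is_stone_cech_compactification (subtopology X (isolated_points X)) X (\<lambda>x. x) \<longleftrightarrow>
           stonean_space X \<and> alpha_scattered_space X)"
proof (intro conjI)
  show "isolated_points (stone_cech X) = stone_cech_map X ` topspace X \<longleftrightarrow>
           X = discrete_topology (topspace X)"
  proof
    assume iso: "isolated_points (stone_cech X) = stone_cech_map X ` topspace X"
    have "openin X {x}" if x: "x \<in> topspace X" for x
    proof -
      have "openin (stone_cech X) {stone_cech_map X x}"
        using iso x by (auto simp: isolated_points_def)
      \<comment> \<open>By injectivity of the canonical map, the preimage of the open singleton is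
        \<open>{x}\<close> itself.\<close>
      then have "openin X {y \<in> topspace X. stone_cech_map X y \<in> {stone_cech_map X x}}"
        by (rule openin_continuous_map_preimage[OF continuous_map_stone_cech_map])
      also have "{y \<in> topspace X. stone_cech_map X y \<in> {stone_cech_map X x}} = {x}"
        using inj_onD[OF inj_on_stone_cech_map[OF assms]] x by auto
      finally show ?thesis .
    qed
    then show "X = discrete_topology (topspace X)"
      by (intro discrete_topology_unique[THEN iffD2, symmetric]) auto
  next
    assume "X = discrete_topology (topspace X)"
    then show "isolated_points (stone_cech X) = stone_cech_map X ` topspace X"
      using isolated_points_stone_cech_discrete[of "topspace X"] by simp
  qed
  show "is_stone_cech_compactification (subtopology X (isolated_points X)) X (\<lambda>x. x) \<longleftrightarrow>
           stonean_space X \<and> alpha_scattered_space X"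
    \<comment> \<open>After rewriting, the claim is about the discrete space on the isolated points
      and their density in \<open>X\<close>.\<close>
    unfolding subtopology_isolated_points alpha_scattered_space_iff_dense_isolated_points
    using is_stone_cech_compactification_isolated_points is_stone_cech_compactification_discreteD
    by blast
qed

end
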